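(* For every general dynamic weighted graph stream of length $m$ of a weighted graph on $n$ vertices, any randomized streaming algorithm that, with probability at least $2/3$, approximates the maximum-weight $1$-matching of the graph to within a factor of $\frac{6}{5}$ uses space $\Omega\!\left(\min\left\{m, \frac{(n-1)(n-2)}{2}\right\}\right)$.
   Context: General dynamic weighted graph streaming model: an undirected graph $G$ on vertex set $\{0,\dots,n-1\}$ with weight function $wt: E\to\mathbb{R}_{\ge 0}$ is given as a stream $(e_{i_1},\Delta_1(e_{i_1})),\ldots,(e_{i_j},\Delta_j(e_{i_j})),\ldots$ of weight updates, where $e_{i_j}$ is a pair of vertices and $\Delta_j(e_{i_j})\in\mathbb{R}$; initially every weight is $0$, and the $j$-th update sets $wt(e_{i_j})\leftarrow wt(e_{i_j})+\Delta_j(e_{i_j})$; it is assumed that all weights remain nonnegative after every update. Thus, in contrast to the standard dynamic model, the weight of an edge may change arbitrarily during the stream. A $1$-matching is a single edge, and a maximum-weight $1$-matching is an edge of maximum weight. *)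

theory Defs
  imports "HOL-Probability.Probability_Mass_Function"
begin

(* Unordered pairs of distinct vertices from {0,...,n-1}. *)
definition vertex_pairs :: "nat \<Rightarrow> nat set set" where
  "vertex_pairs n = {e. e \<subseteq> {..<n} \<and> card e = 2}"

type_synonym update = "nat set \<times> real"

(* Every weight is 0 initially, and an update (e, d) adds d to the weight of e.
   Pairs of weight 0 are regarded as absent from the graph. *)
definition weight :: "update list \<Rightarrow> nat set \<Rightarrow> real" where
  "weight s = fold (\<lambda>(e, d) w. w(e := w e + d)) s (\<lambda>_. 0)"

(* D is the set of real numbers that may occur as weight changes; D = UNIV is the general
   dynamic model, in which weights change arbitrarily.  Smaller sets D are admitted because
   unrestricted reals cannot be tracked in any finite number of bits, so that a lower bound on
   bits for D = UNIV alone would be nearly vacuous. *)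
definition general_dynamic_streams :: "real set \<Rightarrow> nat \<Rightarrow> nat \<Rightarrow> update list set" where
  "general_dynamic_streams D n m =
     {s. length s = m \<and> set s \<subseteq> vertex_pairs n \<times> D \<and>
         (\<forall>k\<le>m. \<forall>e\<in>vertex_pairs n. 0 \<le> weight (take k s) e)}"

(* The memory contents are bit strings.  The algorithm may toss fresh coins when it is
   initialised, whenever it reads an update, and when it produces its output; coins are free, but
   what is to be remembered about them has to be kept in memory.  The algorithm is non-uniform:
   there is no computability requirement, and it may depend on n and m. *)
record 'o streaming_algorithm =
  init :: "bool list pmf"
  step :: "update \<Rightarrow> bool list \<Rightarrow> bool list pmf"
  out :: "bool list \<Rightarrow> 'o pmf"

definition memory :: "'o streaming_algorithm \<Rightarrow> update list \<Rightarrow> bool list pmf" where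
  "memory A s = fold (\<lambda>u p. bind_pmf p (step A u)) s (init A)"

definition result :: "'o streaming_algorithm \<Rightarrow> update list \<Rightarrow> 'o pmf" where
  "result A s = bind_pmf (memory A s) (out A)"

(* Worst-case number of memory bits, over all streams in the given set, all points in time and
   all outcomes of the coin tosses; it may be infinite. *)
definition space_used :: "'o streaming_algorithm \<Rightarrow> update list set \<Rightarrow> enat" where
  "space_used A X = (SUP s\<in>X. SUP k\<in>{..length s}. SUP q\<in>set_pmf (memory A (take k s)). enat (length q))"

definition succeeds_with_prob ::
  "real \<Rightarrow> 'o streaming_algorithm \<Rightarrow> update list set \<Rightarrow> ((nat set \<Rightarrow> real) \<Rightarrow> 'o \<Rightarrow> bool) \<Rightarrow> bool" where
  "succeeds_with_prob p A X correct \<longleftrightarrow>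
     (\<forall>s\<in>X. p \<le> measure_pmf.prob (result A s) {x. correct (weight s) x})"

definition max_weight_1_matching :: "nat \<Rightarrow> (nat set \<Rightarrow> real) \<Rightarrow> nat set \<Rightarrow> bool" where
  "max_weight_1_matching n w e \<longleftrightarrow>
     e \<in> vertex_pairs n \<and> 0 < w e \<and> (\<forall>e'\<in>vertex_pairs n. w e' \<le> w e)"

(* There are two usual meanings of approximating a maximum-weight matching to within a factor a:
   to report a matching whose weight is within this factor of the maximum, or to
   report a number that is within this factor of the maximum weight.  In the first
   case, nothing is required if the graph has no edge and hence no 1-matching. *)
definition approx_1_matching :: "real \<Rightarrow> nat \<Rightarrow> (nat set \<Rightarrow> real) \<Rightarrow> nat set \<Rightarrow> bool" where
  "approx_1_matching a n w e \<longleftrightarrow>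
     (\<forall>e'. max_weight_1_matching n w e' \<longrightarrow> e \<in> vertex_pairs n \<and> w e' \<le> a * w e)"

(* The maximum is 0 for a graph without edges. *)
definition approx_1_matching_weight :: "real \<Rightarrow> nat \<Rightarrow> (nat set \<Rightarrow> real) \<Rightarrow> real \<Rightarrow> bool" where
  "approx_1_matching_weight a n w x \<longleftrightarrow>
     Max (w ` vertex_pairs n) / a \<le> x \<and> x \<le> a * Max (w ` vertex_pairs n)"

end

(* Reduction from the one-way communication problem INDEX.  An algorithm that decides membership
   of every i < k in a set S after reading a prefix depending on S only lets one decode S from its
   memory: by averaging, for each S some memory content z has decision probabilities for which the
   expected number of correct decisions is at least 2k/3.  A fixed z serves few sets: the sum over
   all S of 2^(expected number of correct decisions) factorises into k factors
   2^b + 2^(1-b) <= 3, so z serves at most (3 / 2^(2/3))^k of the 2^k sets.  Hence there are at least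
   (2^(5/3) / 3)^k memory contents.

   For reporting a number, the bit i is the weight of an edge, which is then increased by 1: the
   maximum is 1 or 2.  For reporting an edge, the bit i selects one of two twin edges, and both twins
   are then increased by 1: the selected one becomes the only edge of weight 2, all others have
   weight at most 1. *)
theory Submission
  imports Defs
begin

section \<open>Runs and weights\<close>

text \<open>The rest of a run depends on the prefix only through the memory content
  \<open>z\<close>, which is what makes \<open>z\<close> the message in INDEX.\<close>

lemma fold_bind_pmf:
  "fold (\<lambda>u p. bind_pmf p (f u)) us (bind_pmf p g)
     = bind_pmf p (\<lambda>z. fold (\<lambda>u p. bind_pmf p (f u)) us (g z))"
  by (induction us arbitrary: g) (simp_all add: bind_assoc_pmf)

lemma weight_eq: "weight s e = (\<Sum>(e', d)\<leftarrow>s. if e' = e then d else 0)"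
proof -
  have "fold (\<lambda>(e, d) w. w(e := w e + d)) s w e = w e + (\<Sum>(e', d)\<leftarrow>s. if e' = e then d else 0)" for w :: "nat set \<Rightarrow> real"
    by (induction s arbitrary: w) (auto split: prod.splits)
  then show ?thesis by (simp add: weight_def)
qed

section \<open>Counting the sets served by few memory contents\<close>

text \<open>The convex function \<open>2 powr b\<close> lies below its chord between 0 and
  1.\<close>

lemma two_powr_le:
  fixes b :: real
  assumes "0 \<le> b" "b \<le> 1"
  shows "2 powr b \<le> 1 + b"
proof -
  have "exp ((1 - b) * 0 + b * ln 2) \<le> (1 - b) * exp 0 + b * exp (ln 2 :: real)"
    using convex_onD[OF exp_convex, of b 0 "ln 2"] assms by simp
  then show ?thesis by (simp add: powr_def algebra_simps)
qed

text \<open>Here \<open>\<beta> z i\<close> is the probability of deciding for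
  \<open>i \<in> S\<close> from content \<open>z\<close>. The bound on \<open>card M\<close> is
  cubed to stay within natural numbers: the cube of 2^(5/3) / 3 is 32 / 27.\<close>

lemma index_counting:
  fixes \<beta> :: "'z \<Rightarrow> nat \<Rightarrow> real"
  assumes "finite M" and \<beta>: "\<And>z i. 0 \<le> \<beta> z i" "\<And>z i. \<beta> z i \<le> 1"
    and cover: "\<And>S. S \<subseteq> {..<k} \<Longrightarrow>
      \<exists>z\<in>M. 2/3 * real k \<le> (\<Sum>i<k. if i \<in> S then \<beta> z i else 1 - \<beta> z i)"
  shows "32 ^ k \<le> card M ^ 3 * 27 ^ k"
proof -
  define g where "g z S = (\<Prod>i<k. 2 powr (if i \<in> S then \<beta> z i else 1 - \<beta> z i))" for z S
  have g_powr: "g z S = 2 powr (\<Sum>i<k. if i \<in> S then \<beta> z i else 1 - \<beta> z i)" for z S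
    by (simp add: g_def powr_sum)
  have "2 powr (2/3 * real k) \<le> (\<Sum>z\<in>M. g z S)" if S: "S \<subseteq> {..<k}" for S
  proof -
    obtain z where z: "z \<in> M" "2/3 * real k \<le> (\<Sum>i<k. if i \<in> S then \<beta> z i else 1 - \<beta> z i)"
      using cover[OF S] by blast
    have "2 powr (2/3 * real k) \<le> g z S"
      unfolding g_powr using z by (intro powr_mono) auto
    also have "\<dots> \<le> (\<Sum>z\<in>M. g z S)"
      using z \<open>finite M\<close> by (intro member_le_sum) (auto simp: g_powr)
    finally show ?thesis .
  qed
  then have "(\<Sum>S\<in>Pow {..<k}. 2 powr (2/3 * real k)) \<le> (\<Sum>S\<in>Pow {..<k}. \<Sum>z\<in>M. g z S)"
    by (intro sum_mono) auto
  also have "\<dots> = (\<Sum>z\<in>M. \<Sum>S\<in>Pow {..<k}. g z S)"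
    by (rule sum.swap)
  also have "\<dots> \<le> (\<Sum>z\<in>M. 3 ^ k)"
  proof (rule sum_mono)
    fix z
    have "(\<Sum>S\<in>Pow {..<k}. g z S)
        = (\<Sum>S\<in>Pow {..<k}. (\<Prod>i\<in>S. 2 powr \<beta> z i) * (\<Prod>i\<in>{..<k} - S. 2 powr (1 - \<beta> z i)))"
    proof (rule sum.cong[OF refl])
      fix S assume "S \<in> Pow {..<k}"
      then have S: "S \<subseteq> {..<k}" by simp
      have "g z S = (\<Prod>i\<in>{..<k} - S. 2 powr (if i \<in> S then \<beta> z i else 1 - \<beta> z i)) *
          (\<Prod>i\<in>S. 2 powr (if i \<in> S then \<beta> z i else 1 - \<beta> z i))"
        unfolding g_def by (rule prod.subset_diff[OF S]) simp
      then show "g z S = (\<Prod>i\<in>S. 2 powr \<beta> z i) * (\<Prod>i\<in>{..<k} - S. 2 powr (1 - \<beta> z i))"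
        by (simp add: mult.commute)
    qed
    \<comment> \<open>Multiplying out the product gives one summand per set \<open>S\<close> of
      factors that contribute their first term.\<close>
    also have "\<dots> = (\<Prod>i<k. 2 powr \<beta> z i + 2 powr (1 - \<beta> z i))"
      by (simp add: prod_add)
    also have "\<dots> \<le> (\<Prod>i<k. 3)"
    proof (rule prod_mono)
      fix i
      \<comment> \<open>The two bounds add up to 3 for every value of
        \<open>\<beta> z i\<close>.\<close>
      have "2 powr \<beta> z i \<le> 1 + \<beta> z i" "2 powr (1 - \<beta> z i) \<le> 1 + (1 - \<beta> z i)"
        using \<beta>[of z i] by (intro two_powr_le; simp)+
      then show "0 \<le> 2 powr \<beta> z i + 2 powr (1 - \<beta> z i) \<and> 2 powr \<beta> z i + 2 powr (1 - \<beta> z i) \<le> 3"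
        by (auto intro: add_nonneg_nonneg)
    qed
    finally show "(\<Sum>S\<in>Pow {..<k}. g z S) \<le> 3 ^ k" by simp
  qed
  finally have "2 ^ k * 2 powr (2/3 * real k) \<le> real (card M) * 3 ^ k"
    by (simp add: card_Pow)
  \<comment> \<open>Cubing removes the fractional exponent 2/3.\<close>
  then have "(2 ^ k * 2 powr (2/3 * real k)) ^ 3 \<le> (real (card M) * 3 ^ k) ^ 3"
    by (rule power_mono) simp
  moreover have "(2 powr (2/3 * real k)) ^ 3 = (4::real) ^ k"
  proof -
    have "(2 powr (2/3 * real k)) ^ 3 = 2 powr real (2 * k)"
      by (simp add: powr_power)
    also have "\<dots> = 2 ^ (2 * k)"
      by (rule powr_realpow) simp
    finally show ?thesis by (simp add: power_mult)
  qed
  moreover have "((2::real) ^ k) ^ 3 = 8 ^ k" "((3::real) ^ k) ^ 3 = 27 ^ k"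
    by (simp_all flip: power_mult add: mult.commute[of k]) (simp_all add: power_mult)
  ultimately have "(32::real) ^ k \<le> real (card M) ^ 3 * 27 ^ k"
    by (simp add: power_mult_distrib flip: power_mult_distrib[of 8 4])
  then have "real (32 ^ k) \<le> real (card M ^ 3 * 27 ^ k)" by simp
  then show ?thesis by (simp only: of_nat_le_iff)
qed

section \<open>Averaging over memory contents\<close>

lemma prob_bind_pmf:
  "measure_pmf.prob (bind_pmf p f) Y = (\<integral>z. measure_pmf.prob (f z) Y \<partial>p)"
  unfolding measure_pmf_bind
  by (rule measure_pmf.measure_bind[where N = "count_space UNIV"]) (auto simp: measure_subprob)

text \<open>If all values on the support were below \<open>c\<close>, their weighted average would
  be too.\<close>

lemma exists_ge_expectation:
  fixes f :: "'z \<Rightarrow> real"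
  assumes "finite (set_pmf p)" "c \<le> (\<integral>z. f z \<partial>p)"
  shows "\<exists>z\<in>set_pmf p. c \<le> f z"
proof (rule ccontr)
  assume "\<not> ?thesis"
  then have "f z < c" if "z \<in> set_pmf p" for z using that by auto
  then have "(\<Sum>z\<in>set_pmf p. pmf p z * f z) < (\<Sum>z\<in>set_pmf p. pmf p z * c)"
    using assms(1) set_pmf_not_empty by (intro sum_strict_mono) (auto simp: pmf_positive)
  also have "\<dots> = c"
    using sum_pmf_eq_1[OF assms(1) order_refl] by (simp flip: sum_distrib_right)
  finally show False
    using assms by (subst (asm) integral_measure_pmf[of "set_pmf p"]) auto
qed

lemma card_bool_lists_le: "card {q :: bool list. length q \<le> s} = 2 ^ (s + 1) - 1"
  using card_lists_length_le[of "UNIV :: bool set" s]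
  by (simp add: sum_power2 flip: lessThan_Suc_atMost atLeast0LessThan)

(* The exact count 2^(s+1) - 1 matters for s = 0, where it rules out k = 1. *)
lemma index_space_arith:
  fixes k s :: nat
  assumes "32 ^ k \<le> (2 ^ (s + 1) - 1 :: nat) ^ 3 * 27 ^ k"
  shows "k \<le> 30 * s"
proof (cases "s = 0")
  case True
  with assms have "(32::nat) ^ k \<le> 27 ^ k" by simp
  then have "k = 0" using power_strict_mono[of "27::nat" 32 k] by auto
  then show ?thesis by simp
next
  case False
  have "real (32 ^ k) \<le> real ((2 ^ (s + 1)) ^ 3 * 27 ^ k)"
    using assms by (intro of_nat_mono) (meson diff_le_self le_trans mult_le_mono1 power_mono zero_le)
  then have "(32 / 27) ^ k \<le> ((2::real) ^ (s + 1)) ^ 3"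
    by (simp add: power_divide divide_simps)
  also have "\<dots> = 2 ^ (3 * (s + 1))" by (simp only: power_mult [symmetric] mult.commute)
  \<comment> \<open>Since \<open>s\<close> is at least 1, \<open>s + 1 \<le> 2 * s\<close>.\<close>
  also have "\<dots> \<le> 2 ^ (6 * s)" using False by (intro power_increasing) auto
  \<comment> \<open>Five is the least exponent for which the power of 32/27 reaches 2; this gives 30
    = 5 * 6.\<close>
  also have "\<dots> \<le> ((32 / 27) ^ 5) ^ (6 * s)" by (rule power_mono) (simp_all add: power_divide)
  also have "\<dots> = (32 / 27) ^ (30 * s)" by (simp flip: power_mult)
  finally show ?thesis by (rule power_le_imp_le_exp[rotated]) simp
qed

section \<open>The INDEX reduction\<close>

text \<open>The prefix \<open>P S\<close> encodes the set, \<open>Q i\<close> asks for bit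
  \<open>i\<close>, and outputs in \<open>Y i\<close> count as the answer yes. \<open>Y i\<close>
  must not depend on \<open>S\<close>, which the decoder does not know.\<close>

lemma index_space_lower_bound:
  fixes A :: "'o streaming_algorithm"
  assumes success: "succeeds_with_prob (2/3) A X correct"
    and X: "\<And>S i. S \<subseteq> {..<k} \<Longrightarrow> i < k \<Longrightarrow> P S @ Q i \<in> X"
    and decode: "\<And>S i x. S \<subseteq> {..<k} \<Longrightarrow> i < k \<Longrightarrow>
      correct (weight (P S @ Q i)) x \<Longrightarrow> x \<in> Y i \<longleftrightarrow> i \<in> S"
  shows "enat k \<le> 30 * space_used A X"
proof (cases "k = 0 \<or> space_used A X = \<infinity>")
  case True
  then show ?thesis by (auto simp: enat_0 imult_infinity_right)
next
  case False
  then obtain s where s: "space_used A X = enat s" and "0 < k" by auto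
  \<comment> \<open>The output distribution when query \<open>i\<close> is run from content
    \<open>z\<close>.\<close>
  define K where "K i z = bind_pmf (fold (\<lambda>u p. bind_pmf p (step A u)) (Q i) (return_pmf z)) (out A)" for i z
  have result: "result A (P S @ Q i) = bind_pmf (memory A (P S)) (K i)" for S i
    using fold_bind_pmf[of "step A" "Q i" "memory A (P S)" return_pmf]
    by (simp add: result_def memory_def K_def [abs_def] bind_return_pmf' bind_assoc_pmf)
  define M where "M = {z :: bool list. length z \<le> s}"
  have "finite M"
    using finite_lists_length_le[of "UNIV :: bool set" s] by (simp add: M_def)
  have memory: "set_pmf (memory A (P S)) \<subseteq> M" if "S \<subseteq> {..<k}" for S
  proof
    fix z assume z: "z \<in> set_pmf (memory A (P S))"
    \<comment> \<open>\<open>space_used\<close> sees only prefixes of streams in \<open>X\<close>,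
      so \<open>P S\<close> is completed by some query; \<open>Q 0\<close> is available because
      \<open>0 < k\<close>.\<close>
    define t where "t = P S @ Q 0"
    have t: "t \<in> X" "length (P S) \<in> {..length t}" "z \<in> set_pmf (memory A (take (length (P S)) t))"
      using X[OF that \<open>0 < k\<close>] z by (auto simp: t_def)
    have "enat (length z) \<le> space_used A X"
      unfolding space_used_def
      by (rule SUP_upper2[OF t(1)], rule SUP_upper2[OF t(2)], rule SUP_upper[OF t(3)])
    then show "z \<in> M" by (simp add: s M_def)
  qed
  define \<beta> where "\<beta> z i = measure_pmf.prob (K i z) (Y i)" for z i
  have \<beta>: "measure_pmf.prob (K i z) (if i \<in> S then Y i else - Y i)
      = (if i \<in> S then \<beta> z i else 1 - \<beta> z i)" for z i S
    using measure_pmf.prob_compl[of "Y i" "K i z"] by (simp add: \<beta>_def Compl_eq_Diff_UNIV)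
  have "\<exists>z\<in>M. 2/3 * real k \<le> (\<Sum>i<k. if i \<in> S then \<beta> z i else 1 - \<beta> z i)"
    if S: "S \<subseteq> {..<k}" for S
  proof -
    have fin: "finite (set_pmf (memory A (P S)))"
      using memory[OF S] \<open>finite M\<close> by (rule finite_subset)
    have "2/3 \<le> (\<integral>z. (if i \<in> S then \<beta> z i else 1 - \<beta> z i) \<partial>memory A (P S))" if "i < k" for i
    proof -
      have "2/3 \<le> measure_pmf.prob (result A (P S @ Q i)) {x. correct (weight (P S @ Q i)) x}"
        using success X[OF S that] by (auto simp: succeeds_with_prob_def)
      also have "\<dots> \<le> measure_pmf.prob (result A (P S @ Q i)) (if i \<in> S then Y i else - Y i)"
        using decode[OF S that] by (intro measure_pmf.finite_measure_mono) auto
      finally show ?thesis by (simp only: result prob_bind_pmf \<beta>)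
    qed
    \<comment> \<open>Summing over \<open>i\<close> before choosing \<open>z\<close> yields one
      content that is good for all indices on average.\<close>
    then have "(\<Sum>i<k. 2/3) \<le> (\<Sum>i<k. \<integral>z. (if i \<in> S then \<beta> z i else 1 - \<beta> z i) \<partial>memory A (P S))"
      by (intro sum_mono) auto
    also have "\<dots> = (\<integral>z. (\<Sum>i<k. if i \<in> S then \<beta> z i else 1 - \<beta> z i) \<partial>memory A (P S))"
      using fin by (intro Bochner_Integration.integral_sum [symmetric] integrable_measure_pmf_finite)
    finally have "\<exists>z\<in>set_pmf (memory A (P S)).
        2/3 * real k \<le> (\<Sum>i<k. if i \<in> S then \<beta> z i else 1 - \<beta> z i)"
      by (intro exists_ge_expectation[OF fin]) simp
    then show ?thesis using memory[OF S] by blast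
  qed
  then have "32 ^ k \<le> card M ^ 3 * 27 ^ k"
    by (rule index_counting[OF \<open>finite M\<close>, rotated 2]) (auto simp: \<beta>_def)
  then have "k \<le> 30 * s"
    by (intro index_space_arith) (simp only: M_def card_bool_lists_le)
  then show ?thesis by (simp add: s numeral_eq_enat)
qed

section \<open>Weights of the hard streams\<close>

lemma weight_Nil [simp]: "weight [] e = 0"
  and weight_Cons [simp]: "weight ((e', d) # s) e = (if e' = e then d else 0) + weight s e"
  and weight_append [simp]: "weight (s @ t) e = weight s e + weight t e"
  by (simp_all add: weight_eq)

lemma weight_replicate_0 [simp]: "weight (replicate r (e', 0)) e = 0"
  by (induction r) auto

lemma weight_map_upt:
  "weight (map (\<lambda>i. (g i, c i)) [0..<k]) e = (\<Sum>i<k. if g i = e then c i else 0)"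
  by (simp add: weight_eq comp_def interv_sum_list_conv_sum_set_nat atLeast0LessThan)

lemma weight_map_inj:
  assumes "inj_on g {..<k}" "j < k"
  shows "weight (map (\<lambda>i. (g i, c i)) [0..<k]) (g j) = c j"
proof -
  have "(\<Sum>i<k. if g i = g j then c i else 0) = (\<Sum>i<k. if i = j then c i else 0)"
    using assms by (intro sum.cong) (auto simp: inj_on_def)
  then show ?thesis using assms by (simp add: weight_map_upt)
qed

lemma weight_map_notin:
  "e \<notin> g ` {..<k} \<Longrightarrow> weight (map (\<lambda>i. (g i, c i)) [0..<k]) e = 0"
  unfolding weight_map_upt by (intro sum.neutral) auto

text \<open>Without negative updates no weight can drop below 0, so the hard streams are legal for
  every \<open>D\<close> containing 0 and 1.\<close>

lemma unit_increments_in_streams: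
  assumes "{0, 1} \<subseteq> D" "length s = m" "set s \<subseteq> vertex_pairs n \<times> {0, 1}"
  shows "s \<in> general_dynamic_streams D n m"
proof -
  have "0 \<le> weight (take k s) e" for k e
    unfolding weight_eq using assms(3) set_take_subset[of k s]
    by (intro sum_list_nonneg) auto
  then show ?thesis
    using assms by (auto simp: general_dynamic_streams_def)
qed

section \<open>Lower bounds for reporting an edge and for reporting a number\<close>

lemma finite_vertex_pairs: "finite (vertex_pairs n)"
  and card_vertex_pairs: "card (vertex_pairs n) = n choose 2"
  by (simp_all add: vertex_pairs_def n_subsets)

(* q tells whether there is room for the updates after the prefix.  Without them (needed for
   m <= 2 only) a single bit is encoded, and all maxima drop by 1.  The r updates by 0 pad the
   stream to length m. *)
lemma matching_space_lower_bound:
  fixes A :: "nat set streaming_algorithm"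
  assumes success: "succeeds_with_prob (2/3) A (general_dynamic_streams D n m) (approx_1_matching (6/5) n)"
    and D: "{0, 1} \<subseteq> D"
    and f: "inj_on f ({..<k} \<times> UNIV)" "f ` ({..<k} \<times> (UNIV :: bool set)) \<subseteq> vertex_pairs n"
    and k: "0 < k" "q \<or> k = 1"
    and m: "k + (if q then 2 else 0) + r = m"
  shows "enat k \<le> 30 * space_used A (general_dynamic_streams D n m)"
proof -
  define P where "P S = map (\<lambda>i. (f (i, i \<in> S), 1 :: real)) [0..<k] @ replicate r (f (0, True), 0)" for S
  define Q where "Q i = (if q then [(f (i, True), 1 :: real), (f (i, False), 1)] else [])" for i
  have f_vp: "f (i, b) \<in> vertex_pairs n" if "i < k" for i b
    using f(2) that by blast
  have f_eq: "f (i, b) = f (j, c) \<longleftrightarrow> i = j \<and> b = c" if "i < k" "j < k" for i j b c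
    using inj_on_eq_iff[OF f(1)] that by auto
  show ?thesis
  proof (rule index_space_lower_bound[OF success])
    fix S i assume "S \<subseteq> {..<k}" and i: "i < k"
    show "P S @ Q i \<in> general_dynamic_streams D n m"
      using m i k f_vp by (intro unit_increments_in_streams[OF D]) (auto simp: P_def Q_def)
    fix x assume x: "approx_1_matching (6/5) n (weight (P S @ Q i)) x"
    define w where "w = weight (P S @ Q i)"
    define g where "g j = f (j, j \<in> S)" for j
    have inj: "inj_on g {..<k}"
      by (auto simp: inj_on_def g_def f_eq)
    have w: "w e = weight (map (\<lambda>j. (g j, 1)) [0..<k]) e + of_bool (q \<and> (e = f (i, True) \<or> e = f (i, False)))" for e
      using f_eq[OF i i, of True False] by (auto simp: w_def P_def Q_def g_def)
    have "g i = f (i, True) \<or> g i = f (i, False)"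
      by (cases "i \<in> S") (simp_all add: g_def)
    then have w_max: "w (g i) = 1 + of_bool q"
      unfolding w weight_map_inj[OF inj i] by simp
    have w_other: "w e \<le> of_bool q" if e: "e \<noteq> g i" for e
    proof (cases "e \<in> g ` {..<k}")
      case True
      then obtain j where j: "j < k" "e = g j" by auto
      with e have "j \<noteq> i" by auto
      \<comment> \<open>Two distinct indices exclude \<open>k = 1\<close>, the only case without
        \<open>q\<close>.\<close>
      with k i j have "q" by auto
      moreover have "w e = 1"
        using weight_map_inj[OF inj \<open>j < k\<close>, of "\<lambda>_. 1"] j i \<open>j \<noteq> i\<close>
        by (simp add: w) (simp add: g_def f_eq)
      ultimately show ?thesis by simp
    qed (simp add: w weight_map_notin)
    have "max_weight_1_matching n w (g i)"
      unfolding max_weight_1_matching_def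
    proof (intro conjI ballI)
      show "g i \<in> vertex_pairs n" using i f_vp by (simp add: g_def)
      show "0 < w (g i)" by (simp add: w_max)
      show "w e \<le> w (g i)" for e
        using w_other[of e] w_max by (cases "e = g i") auto
    qed
    then have "w (g i) \<le> 6/5 * w x"
      using x by (auto simp: approx_1_matching_def w_def)
    \<comment> \<open>Any other pair is too light: 6/5 * 1 < 2 with the query updates, 6/5 * 0 < 1
      without them.\<close>
    then have "x = g i"
      using w_max w_other[of x] by (cases q) fastforce+
    then show "x \<in> {f (i, True)} \<longleftrightarrow> i \<in> S"
      using i by (simp add: g_def f_eq)
  qed
qed

lemma weight_space_lower_bound:
  fixes A :: "real streaming_algorithm"
  assumes success: "succeeds_with_prob (2/3) A (general_dynamic_streams D n m) (approx_1_matching_weight (6/5) n)"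
    and D: "{0, 1} \<subseteq> D"
    and f: "inj_on f {..<k}" "f ` {..<k} \<subseteq> vertex_pairs n"
    and k: "0 < k" "q \<or> k = 1"
    and m: "k + of_bool q + r = m"
  shows "enat k \<le> 30 * space_used A (general_dynamic_streams D n m)"
proof -
  \<comment> \<open>A bit 0 is written as an update by 0, so the length of the prefix does not
    depend on \<open>S\<close>.\<close>
  define P where "P S = map (\<lambda>i. (f i, of_bool (i \<in> S) :: real)) [0..<k] @ replicate r (f 0, 0)" for S
  define Q where "Q i = (if q then [(f i, 1 :: real)] else [])" for i
  have f_vp: "f i \<in> vertex_pairs n" if "i < k" for i
    using f(2) that by blast
  show ?thesis
  proof (rule index_space_lower_bound[OF success])
    fix S i assume "S \<subseteq> {..<k}" and i: "i < k"
    show "P S @ Q i \<in> general_dynamic_streams D n m"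
      using m i k f_vp by (intro unit_increments_in_streams[OF D]) (auto simp: P_def Q_def)
    fix x assume x: "approx_1_matching_weight (6/5) n (weight (P S @ Q i)) x"
    define w where "w = weight (P S @ Q i)"
    have w: "w e = weight (map (\<lambda>j. (f j, of_bool (j \<in> S))) [0..<k]) e + of_bool (q \<and> e = f i)" for e
      by (auto simp: w_def P_def Q_def)
    have w_max: "w (f i) = of_bool (i \<in> S) + of_bool q"
      using weight_map_inj[OF f(1) i, of "\<lambda>j. of_bool (j \<in> S)"] by (simp add: w)
    have w_other: "w e \<le> w (f i)" for e
    proof (cases "e \<in> f ` {..<k} \<and> e \<noteq> f i")
      case True
      then obtain j where j: "j < k" "e = f j" "j \<noteq> i" by auto
      with k i have "q" by auto
      moreover have "w e \<le> 1"
        using weight_map_inj[OF f(1) \<open>j < k\<close>, of "\<lambda>j. of_bool (j \<in> S)"] j True by (simp add: w)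
      ultimately show ?thesis by (simp add: w_max)
    next
      case False
      then show ?thesis
        by (cases "e = f i") (auto simp: w[of e] w_max weight_map_notin)
    qed
    have "Max (w ` vertex_pairs n) = of_bool (i \<in> S) + of_bool q"
      unfolding w_max[symmetric] using f_vp[OF i] w_other
      by (intro Max_eqI) (auto simp: finite_vertex_pairs)
    \<comment> \<open>With \<open>q\<close>, the threshold 3/2 separates outputs up to 6/5 from
      those of at least 5/3; without \<open>q\<close>, 1/2 separates 0 from at least 5/6.\<close>
    then show "x \<in> {of_bool q + 1/2..} \<longleftrightarrow> i \<in> S"
      using x by (cases "i \<in> S"; cases q) (auto simp: approx_1_matching_weight_def w_def [symmetric])
  qed
qed

section \<open>Choice of the number of bits\<close>

text \<open>One \<open>k\<close> serves both reductions. Twins need \<open>2 * k\<close> pairs; the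
  paddings \<open>r\<close> and \<open>r'\<close> differ because a query takes two updates for edges
  and one for numbers.\<close>

lemma index_size_exists:
  fixes n m :: nat
  assumes "3 \<le> n" "1 \<le> m"
  obtains k q r r' where "0 < k" "q \<or> k = 1" "2 * k \<le> n choose 2"
    "k + (if q then 2 else 0) + r = m" "k + of_bool q + r' = m"
    "min (real m) ((real n - 1) * (real n - 2) / 2) \<le> 3 * real k"
proof -
  define N where "N = n choose 2"
  have N: "real N = real n * (real n - 1) / 2"
    using assms by (simp add: N_def choose_two real_of_nat_div of_nat_diff)
  have "3 * 2 / 2 \<le> real N"
    unfolding N using assms by (intro divide_right_mono mult_mono) auto
  then have "3 \<le> N" by linarith
  have le_N: "(real n - 1) * (real n - 2) / 2 \<le> real N"
    unfolding N using assms by (simp add: field_simps)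
  show ?thesis
  proof (cases "m \<le> 2")
    case True
    show ?thesis
      by (rule that[of 1 False "m - 1" "m - 1"]) (use True assms \<open>3 \<le> N\<close> in \<open>auto simp: N_def\<close>)
  next
    case False
    define k where "k = min (m - 2) (N div 2)"
    \<comment> \<open>The factor 3 is attained at \<open>m = 3\<close> and at \<open>N = 3\<close>,
      where \<open>k = 1\<close>.\<close>
    have k: "min m N \<le> 3 * k" "0 < k" "2 * k \<le> N" "k + 2 \<le> m"
      using False \<open>3 \<le> N\<close> by (auto simp: k_def min_def)
    have "min (real m) ((real n - 1) * (real n - 2) / 2) \<le> real (min m N)"
      using le_N by (simp add: min_def)
    also have "\<dots> \<le> 3 * real k" using k(1) by linarith
    finally show ?thesis
      by (intro that[of k True "m - k - 2" "m - k - 1"]) (use k in \<open>auto simp: N_def\<close>)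
  qed
qed

theorem theorem13:
  "\<exists>c>0::real. \<forall>n\<ge>1. \<forall>m. \<forall>D. {0, 1} \<subseteq> D \<longrightarrow>
     (\<forall>A :: nat set streaming_algorithm.
        succeeds_with_prob (2/3) A (general_dynamic_streams D n m) (approx_1_matching (6/5) n) \<longrightarrow>
        ereal (c * min (real m) ((real n - 1) * (real n - 2) / 2))
          \<le> ereal_of_enat (space_used A (general_dynamic_streams D n m))) \<and>
     (\<forall>A :: real streaming_algorithm.
        succeeds_with_prob (2/3) A (general_dynamic_streams D n m) (approx_1_matching_weight (6/5) n) \<longrightarrow>
        ereal (c * min (real m) ((real n - 1) * (real n - 2) / 2))
          \<le> ereal_of_enat (space_used A (general_dynamic_streams D n m)))"
\<comment> \<open>90 = 30 * 3: the loss in the INDEX bound times the loss in the choice of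
  \<open>k\<close>.\<close>
proof (rule exI[of _ "1 / 90"], intro conjI allI impI)
  fix n m :: nat and D :: "real set"
  assume "1 \<le> n" and D: "{0, 1} \<subseteq> D"
  define X where "X = general_dynamic_streams D n m"
  define b where "b = min (real m) ((real n - 1) * (real n - 2) / 2)"
  have "(\<forall>A. succeeds_with_prob (2/3) A X (approx_1_matching (6/5) n) \<longrightarrow>
           ereal (1 / 90 * b) \<le> ereal_of_enat (space_used A X)) \<and>
        (\<forall>A. succeeds_with_prob (2/3) A X (approx_1_matching_weight (6/5) n) \<longrightarrow>
           ereal (1 / 90 * b) \<le> ereal_of_enat (space_used A X))"
  proof (cases "3 \<le> n \<and> 1 \<le> m")
    case False
    then have "m = 0 \<or> n = 1 \<or> n = 2" using \<open>1 \<le> n\<close> by auto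
    \<comment> \<open>In these degenerate cases the claimed bound is trivial.\<close>
    then have "b \<le> 0" by (auto simp: b_def)
    then have "ereal (1 / 90 * b) \<le> ereal_of_enat x" for x
      by (intro order_trans[OF _ ereal_of_enat_nonneg]) simp
    then show ?thesis by simp
  next
    case True
    then obtain k q r r' where k: "0 < k" "q \<or> k = 1" "2 * k \<le> n choose 2"
        "k + (if q then 2 else 0) + r = m" "k + of_bool q + r' = m" "b \<le> 3 * real k"
      unfolding b_def using index_size_exists by blast
    have bound: "ereal (1 / 90 * b) \<le> ereal_of_enat x" if "enat k \<le> 30 * x" for x
      using that k(6) by (cases x) (auto simp: numeral_eq_enat)
    have "card ({..<k} \<times> (UNIV :: bool set)) \<le> card (vertex_pairs n)"
      using k(3) by (simp add: card_cartesian_product card_vertex_pairs)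
    then obtain f where f: "f ` ({..<k} \<times> (UNIV :: bool set)) \<subseteq> vertex_pairs n"
        "inj_on f ({..<k} \<times> (UNIV :: bool set))"
      using card_le_inj[of "{..<k} \<times> (UNIV :: bool set)" "vertex_pairs n"] finite_vertex_pairs by auto
    \<comment> \<open>Reporting a number uses only one twin of each index.\<close>
    have f': "inj_on (\<lambda>i. f (i, True)) {..<k}" "(\<lambda>i. f (i, True)) ` {..<k} \<subseteq> vertex_pairs n"
      using f by (auto simp: inj_on_def)
    show ?thesis
      unfolding X_def using bound
        matching_space_lower_bound[OF _ D f(2) f(1) k(1,2,4)]
        weight_space_lower_bound[OF _ D f' k(1,2,5)] by blast
  qed
  then show "succeeds_with_prob (2/3) A (general_dynamic_streams D n m) (approx_1_matching (6/5) n) \<Longrightarrow>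
      ereal (1 / 90 * min (real m) ((real n - 1) * (real n - 2) / 2))
        \<le> ereal_of_enat (space_used A (general_dynamic_streams D n m))"
    and "succeeds_with_prob (2/3) B (general_dynamic_streams D n m) (approx_1_matching_weight (6/5) n) \<Longrightarrow>
      ereal (1 / 90 * min (real m) ((real n - 1) * (real n - 2) / 2))
        \<le> ereal_of_enat (space_used B (general_dynamic_streams D n m))" for A B
    by (simp_all add: X_def b_def)
qed simp

end
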